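(* Let $p$ be an odd prime and let $f = ax+b \in \mathbb{F}_p[x]$ be a linear polynomial (so $a \in \mathbb{F}_p^\times$) with leading coefficient $a \neq 1$. Let $d \geq 0$ be an integer, and let $r$ be the multiplicative order of $a$ in $\mathbb{F}_p^\times$. Then \[ \#C_d(f) = \begin{cases} (p-1)p^{\frac{d-1}{r}}, & \text{if } d \equiv 1 \pmod{r},\\ 0, & \text{if } d \not\equiv 1 \pmod{r}. \end{cases} \]
   Context: For $f \in \mathbb{F}_p[x]$ and an integer $d$, $C_d(f)$ denotes the set $\{ g \in \mathbb{F}_p[x] : f\circ g = g \circ f \text{ and } \deg(g) = d\}$, where $\circ$ is composition of polynomials.
   Formalization: The case d = 0 with b ≠ 0 is excluded, since there the nonzero constant b/(1−a) commutes with f and #C_0(f) = 1, not 0 (e.g. p = 3, f = 2x+1, g = 2); the zero polynomial is taken to have degree −∞ and so lies in no C_d(f). *)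

theory Defs
  imports
    "HOL-Computational_Algebra.Polynomial"
    "HOL-Algebra.Multiplicative_Group"
    "Berlekamp_Zassenhaus.Finite_Field"
begin

definition units_group :: "'a::field monoid" where
  "units_group = \<lparr>carrier = UNIV - {0}, monoid.mult = (*), one = 1\<rparr>"

(* group.ord is only meaningful for an actual group. *)
lemma group_units_group: "group (units_group :: 'a::field monoid)"
proof (rule groupI)
  fix x :: 'a assume "x \<in> carrier units_group"
  then show "\<exists>y\<in>carrier units_group. y \<otimes>\<^bsub>units_group\<^esub> x = \<one>\<^bsub>units_group\<^esub>"
    by (intro bexI[of _ "inverse x"]) (simp_all add: units_group_def)
qed (simp_all add: units_group_def mult.assoc)

(* The polynomial 0 has degree minus infinity, so it belongs to no C_d(f); the
   condition g \<noteq> 0 is needed because the library sets degree 0 = 0. *)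
definition commuting_polys :: "nat \<Rightarrow> 'a::field poly \<Rightarrow> 'a poly set" where
  "commuting_polys d f = {g. f \<circ>\<^sub>p g = g \<circ>\<^sub>p f \<and> g \<noteq> 0 \<and> degree g = d}"

(* The fixed point of a x + b is a constant polynomial commuting with it. If b \<noteq> 0 it
   has degree 0, so the count is 1 for d = 0 although 0 is not congruent to 1 mod r. *)
lemma commuting_polys_0:
  fixes a b :: "'p::prime_card mod_ring"
  assumes a: "a \<noteq> 1" and b: "b \<noteq> 0"
  shows "commuting_polys 0 [:b,a:] = {[:b/(1-a):]}"
proof -
  have "b / (1-a) \<noteq> 0" using a b by simp
  moreover have "(b + a*c = c) = (c = b/(1-a))" for c
    using a by (auto simp: field_simps)
  ultimately show ?thesis
    unfolding commuting_polys_def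
    using b by (auto simp: field_simps pCons_eq_iff elim!: degree_eq_zeroE)
qed

end

theory Submission
  imports Defs
begin

text \<open>
  Conjugating by the translation that moves the fixed point of \<open>a x + b\<close> to the origin reduces
  the count to the case \<open>b = 0\<close>. A polynomial \<open>h\<close> commutes with \<open>a x\<close> iff \<open>h (a x) = a h x\<close>,
  that is, iff \<open>a ^ i = a\<close> for every \<open>i\<close> in the support of \<open>h\<close>, and this means \<open>i \<equiv> 1\<close> modulo the
  order of \<open>a\<close>. If \<open>d = 1 + k r\<close>, such an \<open>h\<close> of degree \<open>d\<close> is given by its \<open>k\<close> free coefficients
  at \<open>1, 1 + r, \<dots>\<close> below \<open>d\<close> and by a nonzero leading coefficient.
\<close>

lemma units_group_pow: "x [^]\<^bsub>units_group\<^esub> (n::nat) = x ^ n"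
proof (induction n)
  case 0
  then show ?case by (simp add: units_group_def nat_pow_def)
next
  case (Suc n)
  then show ?case by (simp add: units_group_def nat_pow_def)
qed

lemma power_eq_1_iff_ord_dvd:
  fixes a :: "'a::field"
  assumes "a \<noteq> 0"
  shows "a ^ n = 1 \<longleftrightarrow> group.ord units_group a dvd n"
  using group.pow_eq_id[OF group_units_group, of a n] assms
  by (simp add: units_group_pow) (simp add: units_group_def)

text \<open>For \<open>i > 0\<close> one factor \<open>a\<close> cancels and leaves
  \<open>a ^ (i - 1) = 1\<close>. For \<open>i = 0\<close> both sides are false, since
  \<open>a \<noteq> 1\<close> forces the order to differ from 1.\<close>

lemma power_eq_self_iff_cong_ord:
  fixes a :: "'a::field"
  assumes "a \<noteq> 0" "a \<noteq> 1"
  shows "a ^ i = a \<longleftrightarrow> [i = 1] (mod group.ord units_group a)"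
proof (cases i)
  case 0
  have "group.ord units_group a \<noteq> 1"
    using power_eq_1_iff_ord_dvd[OF assms(1), of 1] assms(2) by auto
  then show ?thesis
    using 0 assms by (auto simp: cong_def cong_0_1_nat')
next
  case (Suc n)
  have "a ^ i = a \<longleftrightarrow> a ^ n = 1"
    using Suc assms by simp
  also have "\<dots> \<longleftrightarrow> [i = 1] (mod group.ord units_group a)"
    using Suc cong_add_rcancel_0_nat[of n 1 "group.ord units_group a"]
    by (simp add: power_eq_1_iff_ord_dvd[OF assms(1)] cong_0_iff)
  finally show ?thesis .
qed

lemma ord_units_group_pos:
  fixes a :: "'a::{finite,field}"
  assumes "a \<noteq> 0"
  shows "group.ord units_group a > 0"
  using group.ord_ge_1[OF group_units_group, of a] assms
  by (simp add: units_group_def)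

text \<open>The coefficients of degree \<open>i\<close> on the two sides are
  \<open>a * coeff h i\<close> and \<open>a ^ i * coeff h i\<close>.\<close>

lemma commute_scale_iff:
  fixes h :: "'a::field poly"
  shows "[:0, a:] \<circ>\<^sub>p h = h \<circ>\<^sub>p [:0, a:] \<longleftrightarrow> (\<forall>i. coeff h i \<noteq> 0 \<longrightarrow> a ^ i = a)"
proof -
  have "[:0, a:] \<circ>\<^sub>p h = smult a h"
    by (simp add: pcompose_pCons)
  then show ?thesis
    by (auto simp: poly_eq_iff coeff_pcompose_linear)
qed

text \<open>
  The condition for \<open>d = 0\<close> is there because conjugation by a translation can turn a nonzero
  constant into \<open>0\<close>.
\<close>

lemma bij_betw_commuting_polys_conjugate:
  fixes f s t :: "'a::field poly"
  assumes st: "s \<circ>\<^sub>p t = [:0, 1:]" and ts: "t \<circ>\<^sub>p s = [:0, 1:]"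
    and deg: "degree s = 1" "degree t = 1"
    and d0: "d = 0 \<Longrightarrow> s = [:0, 1:] \<and> t = [:0, 1:]"
  shows "bij_betw (\<lambda>g. t \<circ>\<^sub>p g \<circ>\<^sub>p s) (commuting_polys d f) (commuting_polys d (t \<circ>\<^sub>p f \<circ>\<^sub>p s))"
proof -
  have cancel: "s \<circ>\<^sub>p (t \<circ>\<^sub>p q) = q" "t \<circ>\<^sub>p (s \<circ>\<^sub>p q) = q" for q
    by (simp_all add: pcompose_assoc st ts pcompose_pCons)
  \<comment> \<open>Kept general in \<open>f\<close>, \<open>s'\<close> and \<open>t'\<close>, so
    that it serves both for the map and, with \<open>s\<close> and \<open>t\<close> swapped, for its
    inverse.\<close>
  have step: "t' \<circ>\<^sub>p g \<circ>\<^sub>p s' \<in> commuting_polys d (t' \<circ>\<^sub>p f \<circ>\<^sub>p s')"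
    if "g \<in> commuting_polys d f" and inv: "\<And>q. s' \<circ>\<^sub>p (t' \<circ>\<^sub>p q) = q"
      and "degree s' = 1" "degree t' = 1" and d0': "d = 0 \<Longrightarrow> s' = [:0, 1:] \<and> t' = [:0, 1:]"
    for f g s' t' :: "'a poly"
  proof -
    have g: "f \<circ>\<^sub>p g = g \<circ>\<^sub>p f" "g \<noteq> 0" "degree g = d"
      using that(1) by (auto simp: commuting_polys_def)
    have "(t' \<circ>\<^sub>p f \<circ>\<^sub>p s') \<circ>\<^sub>p (t' \<circ>\<^sub>p g \<circ>\<^sub>p s') = t' \<circ>\<^sub>p (f \<circ>\<^sub>p g) \<circ>\<^sub>p s'"
      by (simp add: pcompose_assoc[symmetric] inv)
    also have "\<dots> = (t' \<circ>\<^sub>p g \<circ>\<^sub>p s') \<circ>\<^sub>p (t' \<circ>\<^sub>p f \<circ>\<^sub>p s')"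
      by (simp add: g(1)) (simp add: pcompose_assoc[symmetric] inv)
    finally have comm: "(t' \<circ>\<^sub>p f \<circ>\<^sub>p s') \<circ>\<^sub>p (t' \<circ>\<^sub>p g \<circ>\<^sub>p s') = (t' \<circ>\<^sub>p g \<circ>\<^sub>p s') \<circ>\<^sub>p (t' \<circ>\<^sub>p f \<circ>\<^sub>p s')" .
    have degree: "degree (t' \<circ>\<^sub>p g \<circ>\<^sub>p s') = d"
      using that g by simp
    moreover have "t' \<circ>\<^sub>p g \<circ>\<^sub>p s' \<noteq> 0"
    proof (cases "d = 0")
      case True
      \<comment> \<open>Here \<open>s'\<close> and \<open>t'\<close> are the identity, so the
        conjugate is \<open>g\<close> itself.\<close>
      then show ?thesis using d0' g(2) by (simp add: pcompose_pCons)
    next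
      case False
      then show ?thesis using degree by (metis degree_0)
    qed
    ultimately show ?thesis using comm by (simp add: commuting_polys_def)
  qed
  show ?thesis
  proof (rule bij_betw_byWitness[where f' = "\<lambda>h. s \<circ>\<^sub>p h \<circ>\<^sub>p t"])
    have "s \<circ>\<^sub>p h \<circ>\<^sub>p t \<in> commuting_polys d f" if "h \<in> commuting_polys d (t \<circ>\<^sub>p f \<circ>\<^sub>p s)" for h
      using step[of h "t \<circ>\<^sub>p f \<circ>\<^sub>p s" t s] that deg d0
      by (simp add: cancel pcompose_assoc[symmetric] st)
    then show "(\<lambda>h. s \<circ>\<^sub>p h \<circ>\<^sub>p t) ` commuting_polys d (t \<circ>\<^sub>p f \<circ>\<^sub>p s) \<subseteq> commuting_polys d f"
      by blast
    show "(\<lambda>g. t \<circ>\<^sub>p g \<circ>\<^sub>p s) ` commuting_polys d f \<subseteq> commuting_polys d (t \<circ>\<^sub>p f \<circ>\<^sub>p s)"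
      using step[OF _ cancel(1) deg d0] by blast
  qed (simp_all add: cancel pcompose_assoc[symmetric] st ts)
qed

text \<open>For \<open>r = 1\<close> the constant coefficient would be free as well, hence \<open>r > 1\<close>.\<close>

lemma card_polys_support_progression:
  fixes r k :: nat
  assumes "r > 1"
  shows "card {h :: 'a::{finite,field} poly. h \<noteq> 0 \<and> degree h = 1 + r * k \<and>
           (\<forall>i. coeff h i \<noteq> 0 \<longrightarrow> [i = 1] (mod r))} = (CARD('a) - 1) * CARD('a) ^ k"
    (is "card ?H = _")
proof -
  \<comment> \<open>\<open>A j\<close> collects the admissible coefficients at
    \<open>1 + r * j\<close>: only the leading one, \<open>j = k\<close>, has to be nonzero. The
    restriction to \<open>{..k}\<close> in \<open>coeffs_of\<close> makes its values extensional, as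
    \<open>PiE\<close> demands.\<close>
  define A where "A j = (if j = k then UNIV - {0} else UNIV :: 'a set)" for j
  define coeffs_of where "coeffs_of h = (\<lambda>j\<in>{..k}. coeff h (1 + r * j))" for h :: "'a poly"
  define poly_of where "poly_of u = (\<Sum>j\<le>k. monom (u j) (1 + r * j))" for u :: "nat \<Rightarrow> 'a"
  have coeff_in: "coeff (poly_of u) (1 + r * j) = u j" if "j \<le> k" for u j
  proof -
    \<comment> \<open>As \<open>r > 0\<close>, the exponents \<open>1 + r * j\<close> are distinct,
      so a single monomial contributes.\<close>
    have "coeff (poly_of u) (1 + r * j) = (\<Sum>i\<le>k. if i = j then u i else 0)"
      using assms unfolding poly_of_def coeff_sum by (intro sum.cong) auto
    then show ?thesis using that by simp
  qed
  have coeff_out: "coeff (poly_of u) i = 0" if "\<And>j. j \<le> k \<Longrightarrow> i \<noteq> 1 + r * j" for u i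
    unfolding poly_of_def coeff_sum by (rule sum.neutral) (use that in auto)
  have cong_D: "\<exists>j\<le>k. i = 1 + r * j" if "[i = 1] (mod r)" "i \<le> 1 + r * k" for i
  proof -
    \<comment> \<open>For \<open>r > 1\<close>, 0 is not congruent to 1.\<close>
    have "i > 0"
      using that(1) assms by (cases "i = 0") (auto simp: cong_def)
    have "r dvd i - 1"
      using that(1) \<open>i > 0\<close> by (metis One_nat_def Suc_leI cong_altdef_nat)
    then obtain j where "i - 1 = r * j" ..
    then have j: "i = 1 + r * j" using \<open>i > 0\<close> by simp
    with that(2) assms have "j \<le> k" by simp
    with j show ?thesis by blast
  qed
  have poly_of_coeffs_of: "poly_of (coeffs_of h) = h" if "h \<in> ?H" for h
  proof (rule poly_eqI)
    fix i
    show "coeff (poly_of (coeffs_of h)) i = coeff h i"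
    proof (cases "\<exists>j\<le>k. i = 1 + r * j")
      case True
      then obtain j where j: "j \<le> k" "i = 1 + r * j" by blast
      then show ?thesis
        using coeff_in[OF j(1), of "coeffs_of h"] by (simp add: coeffs_of_def)
    next
      case False
      then have "coeff h i = 0"
        using that cong_D[of i] le_degree[of h i] by (cases "coeff h i = 0") auto
      with False coeff_out[of i "coeffs_of h"] show ?thesis by auto
    qed
  qed
  have "bij_betw coeffs_of ?H (PiE {..k} A)"
  proof (rule bij_betw_byWitness[where f' = poly_of])
    show "\<forall>h\<in>?H. poly_of (coeffs_of h) = h"
      using poly_of_coeffs_of by blast
    show "\<forall>u\<in>PiE {..k} A. coeffs_of (poly_of u) = u"
    proof
      fix u assume "u \<in> PiE {..k} A"
      then show "coeffs_of (poly_of u) = u"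
        unfolding coeffs_of_def
        by (intro extensionalityI[where A = "{..k}"]) (use coeff_in in \<open>auto simp: PiE_def\<close>)
    qed
    show "coeffs_of ` ?H \<subseteq> PiE {..k} A"
    proof
      fix u assume "u \<in> coeffs_of ` ?H"
      then obtain h where h: "u = coeffs_of h" "h \<noteq> 0" "degree h = 1 + r * k" by blast
      then have "coeff h (1 + r * k) \<noteq> 0"
        by (metis leading_coeff_0_iff)
      with h(1) show "u \<in> PiE {..k} A"
        by (auto simp: coeffs_of_def A_def)
    qed
    show "poly_of ` PiE {..k} A \<subseteq> ?H"
    proof
      fix h assume "h \<in> poly_of ` PiE {..k} A"
      then obtain u where u: "u \<in> PiE {..k} A" and h: "h = poly_of u" by blast
      have lead: "coeff h (1 + r * k) \<noteq> 0"
        using PiE_mem[OF u, of k] coeff_in[of k u] by (simp add: h A_def)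
      have supp: "\<exists>j\<le>k. i = 1 + r * j" if "coeff h i \<noteq> 0" for i
        using that coeff_out[of i u] h by blast
      have "degree h \<le> 1 + r * k"
      proof (rule degree_le, intro allI impI)
        fix i assume i: "1 + r * k < i"
        have "i \<noteq> 1 + r * j" if "j \<le> k" for j
          using i mult_le_mono2[OF that, of r] by linarith
        then show "coeff h i = 0" using supp by blast
      qed
      moreover have "1 + r * k \<le> degree h"
        using lead by (rule le_degree)
      moreover have "[i = 1] (mod r)" if "coeff h i \<noteq> 0" for i
        using supp[OF that] by (auto simp: cong_def mod_Suc)
      moreover have "h \<noteq> 0" using lead by auto
      ultimately show "h \<in> ?H" by auto
    qed
  qed
  then have "card ?H = (\<Prod>j\<le>k. card (A j))"
    by (simp add: bij_betw_same_card card_PiE)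
  also have "\<dots> = card (A k) * (\<Prod>j<k. card (A j))"
    by (simp add: lessThan_Suc_atMost[symmetric] mult.commute)
  also have "\<dots> = (CARD('a) - 1) * CARD('a) ^ k"
    by (simp add: A_def card_Diff_singleton)
  finally show ?thesis .
qed

theorem theorem5p1:
  fixes a b :: "'p::prime_card mod_ring" and f :: "'p mod_ring poly" and p d r :: nat
  assumes "p = CARD('p)" and "prime p" and "odd p"
    and "f = [:b, a:]" and "a \<noteq> 0" and "a \<noteq> 1"
    and "r = group.ord units_group a"
    and "d = 0 \<longrightarrow> b = 0"
  shows "card (commuting_polys d f) =
    (if [d = 1] (mod r) then (p - 1) * p ^ ((d - 1) div r) else 0)"
proof -
  \<comment> \<open>\<open>c\<close> is the fixed point of \<open>f\<close>, which the translation
    moves to the origin.\<close>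
  define c where "c = b / (1 - a)"
  have fix_c: "b + a * c = c"
    using assms(6) by (simp add: c_def field_simps)
  \<comment> \<open>If \<open>d = 0\<close>, then \<open>b = 0\<close> gives \<open>c = 0\<close>,
    so both translations are the identity.\<close>
  have "bij_betw (\<lambda>g. [:- c, 1:] \<circ>\<^sub>p g \<circ>\<^sub>p [:c, 1:]) (commuting_polys d f)
    (commuting_polys d ([:- c, 1:] \<circ>\<^sub>p f \<circ>\<^sub>p [:c, 1:]))"
    using assms(8)
    by (intro bij_betw_commuting_polys_conjugate) (auto simp: pcompose_pCons c_def)
  moreover have "[:- c, 1:] \<circ>\<^sub>p f \<circ>\<^sub>p [:c, 1:] = [:0, a:]"
    using fix_c assms(4) by (simp add: pcompose_pCons algebra_simps)
  ultimately have "card (commuting_polys d f) = card (commuting_polys d [:0, a:])"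
    by (simp add: bij_betw_same_card)
  also have "commuting_polys d [:0, a:] =
      {h. h \<noteq> 0 \<and> degree h = d \<and> (\<forall>i. coeff h i \<noteq> 0 \<longrightarrow> [i = 1] (mod r))}" (is "_ = ?H d")
    unfolding commuting_polys_def commute_scale_iff power_eq_self_iff_cong_ord[OF assms(5,6)] assms(7)
    by blast
  also have "card (?H d) = (if [d = 1] (mod r) then (p - 1) * p ^ ((d - 1) div r) else 0)"
  proof (cases "[d = 1] (mod r)")
    case True
    \<comment> \<open>This is \<open>a ^ 0 \<noteq> a\<close>. It yields both
      \<open>r \<noteq> 1\<close> and \<open>d \<noteq> 0\<close>; the latter keeps the natural
      number \<open>d - 1\<close> from being truncated.\<close>
    have 0: "\<not> [0 = 1] (mod r)"
      using power_eq_self_iff_cong_ord[OF assms(5,6), of 0] assms(6,7) by auto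
    then have "r \<noteq> 1" by auto
    then have r: "r > 1"
      using ord_units_group_pos[OF assms(5)] assms(7) by linarith
    have "d \<noteq> 0"
      using 0 True by metis
    then have "r dvd d - 1"
      using True by (metis One_nat_def Suc_leI cong_altdef_nat neq0_conv)
    then have d: "1 + r * ((d - 1) div r) = d"
      using \<open>d \<noteq> 0\<close> by simp
    have "CARD('p mod_ring) = p"
      using assms(1) by simp
    then show ?thesis
      using card_polys_support_progression[OF r, of "(d - 1) div r", where 'a = "'p mod_ring"] True
      unfolding d by simp
  next
    case False
    \<comment> \<open>The leading coefficient would put \<open>d\<close> into the support.\<close>
    then have "?H d = {}"
      using leading_coeff_neq_0 by blast
    then show ?thesis using False by (metis card.empty)
  qed
  finally show ?thesis .
qed

end
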